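(* Let $\gamma>0$ be a real number. There is a monoidal natural transformation $\mathsf{gd}^\gamma\colon\mathsf{Opt}\Rightarrow\mathsf{Dynam}_D$ whose component at a finite set $N$, $\mathsf{gd}^\gamma_N\colon\mathsf{Opt}(N)\to\mathsf{Dynam}_D(N)$, is given by $f\mapsto\mathrm{id}_{\mathbb{R}^N}-\gamma\nabla f$.
   Context: For a finite set $N$, $\mathbb{R}^N$ is the vector space of functions $N\to\mathbb{R}$. For a function $\phi\colon N\to M$ of finite sets, the pullback $\phi^*\colon\mathbb{R}^M\to\mathbb{R}^N$ is $\phi^*(y)_i=y_{\phi(i)}$ and the pushforward $\phi_*\colon\mathbb{R}^N\to\mathbb{R}^M$ is $\phi_*(x)_j=\sum_{i\in\phi^{-1}(j)}x_i$. $\iota_N\colon N\to N+M$ and $\iota_M\colon M\to N+M$ denote the inclusions into the disjoint union. $(\mathbf{FinSet},+)$ has disjoint union as monoidal product, $(\mathbf{Set},\times)$ has Cartesian product. $\mathsf{Opt}\colon(\mathbf{FinSet},+)\to(\mathbf{Set},\times)$ is the lax symmetric monoidal functor with $\mathsf{Opt}(N)=\{f\colon\mathbb{R}^N\to\mathbb{R}\mid f\in C^1\}$; $\mathsf{Opt}(\phi)(f)=f\circ\phi^*$; product comparison $(f,g)\mapsto f\circ\iota_N^*+g\circ\iota_M^*$; unit comparison picking the zero function on $\mathbb{R}^0$. $\mathsf{Dynam}_D\colon(\mathbf{FinSet},+)\to(\mathbf{Set},\times)$ (discrete dynamical systems) is the lax symmetric monoidal functor with $\mathsf{Dynam}_D(N)$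 the set of maps $\upsilon\colon\mathbb{R}^N\to\mathbb{R}^N$; $\mathsf{Dynam}_D(\phi)(\upsilon)=\mathrm{id}_{\mathbb{R}^M}+\phi_*\circ(\upsilon-\mathrm{id}_{\mathbb{R}^N})\circ\phi^*$ for $\phi\colon N\to M$; product comparison $(\upsilon,\rho)\mapsto\iota_{N*}\circ\upsilon\circ\iota_N^*+\iota_{M*}\circ\rho\circ\iota_M^*$; unit comparison the unique map $\{*\}\to\mathsf{Dynam}_D(\emptyset)$. *)

theory Defs
  imports "HOL-Analysis.Analysis"
begin

section \<open>Symmetric monoidal categories\<close>

text \<open>\<open>comp C g f\<close> is \<open>g\<close> after \<open>f\<close>.\<close>

record ('o, 'm) sym_mon_category =
  obj :: "'o set"
  arr :: "'m set"
  source :: "'m \<Rightarrow> 'o"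
  target :: "'m \<Rightarrow> 'o"
  ident :: "'o \<Rightarrow> 'm"
  comp :: "'m \<Rightarrow> 'm \<Rightarrow> 'm"  (infixr "\<cdot>\<index>" 75)
  tensor_obj :: "'o \<Rightarrow> 'o \<Rightarrow> 'o"  (infixr "\<otimes>\<index>" 80)
  tensor_arr :: "'m \<Rightarrow> 'm \<Rightarrow> 'm"  (infixr "\<odot>\<index>" 80)
  unit_obj :: "'o"
  associator :: "'o \<Rightarrow> 'o \<Rightarrow> 'o \<Rightarrow> 'm"
  left_unitor :: "'o \<Rightarrow> 'm"
  right_unitor :: "'o \<Rightarrow> 'm"
  braiding :: "'o \<Rightarrow> 'o \<Rightarrow> 'm"

definition hom :: "('o, 'm) sym_mon_category \<Rightarrow> 'o \<Rightarrow> 'o \<Rightarrow> 'm set" where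
  "hom C A B = {f \<in> arr C. source C f = A \<and> target C f = B}"

definition iso :: "('o, 'm) sym_mon_category \<Rightarrow> 'o \<Rightarrow> 'o \<Rightarrow> 'm set" where
  "iso C A B = {f \<in> hom C A B. \<exists>g \<in> hom C B A.
     comp C g f = ident C A \<and> comp C f g = ident C B}"

locale symmetric_monoidal_category =
  fixes C :: "('o, 'm) sym_mon_category" (structure)
  assumes source_obj: "f \<in> arr C \<Longrightarrow> source C f \<in> obj C"
    and target_obj: "f \<in> arr C \<Longrightarrow> target C f \<in> obj C"
    and ident_hom: "A \<in> obj C \<Longrightarrow> ident C A \<in> hom C A A"
    and comp_hom: "\<lbrakk>f \<in> hom C A B; g \<in> hom C B D\<rbrakk> \<Longrightarrow> g \<cdot> f \<in> hom C A D"
    and comp_ident: "f \<in> hom C A B \<Longrightarrow> f \<cdot> ident C A = f"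
    and ident_comp: "f \<in> hom C A B \<Longrightarrow> ident C B \<cdot> f = f"
    and comp_assoc: "\<lbrakk>f \<in> hom C A B; g \<in> hom C B D; h \<in> hom C D E\<rbrakk>
      \<Longrightarrow> (h \<cdot> g) \<cdot> f = h \<cdot> (g \<cdot> f)"
    and unit_obj: "unit_obj C \<in> obj C"
    and tensor_obj: "\<lbrakk>A \<in> obj C; B \<in> obj C\<rbrakk> \<Longrightarrow> A \<otimes> B \<in> obj C"
    and tensor_hom: "\<lbrakk>f \<in> hom C A A'; g \<in> hom C B B'\<rbrakk>
      \<Longrightarrow> f \<odot> g \<in> hom C (A \<otimes> B) (A' \<otimes> B')"
    and tensor_ident: "\<lbrakk>A \<in> obj C; B \<in> obj C\<rbrakk>
      \<Longrightarrow> ident C A \<odot> ident C B = ident C (A \<otimes> B)"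
    and tensor_comp: "\<lbrakk>f \<in> hom C A A'; f' \<in> hom C A' A''; g \<in> hom C B B'; g' \<in> hom C B' B''\<rbrakk>
      \<Longrightarrow> (f' \<cdot> f) \<odot> (g' \<cdot> g) = (f' \<odot> g') \<cdot> (f \<odot> g)"
    and associator_iso: "\<lbrakk>A \<in> obj C; B \<in> obj C; D \<in> obj C\<rbrakk>
      \<Longrightarrow> associator C A B D \<in> iso C ((A \<otimes> B) \<otimes> D) (A \<otimes> (B \<otimes> D))"
    and associator_natural: "\<lbrakk>f \<in> hom C A A'; g \<in> hom C B B'; h \<in> hom C D D'\<rbrakk>
      \<Longrightarrow> associator C A' B' D' \<cdot> ((f \<odot> g) \<odot> h) = (f \<odot> (g \<odot> h)) \<cdot> associator C A B D"
    and left_unitor_iso: "A \<in> obj C \<Longrightarrow> left_unitor C A \<in> iso C (unit_obj C \<otimes> A) A"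
    and left_unitor_natural: "f \<in> hom C A B
      \<Longrightarrow> left_unitor C B \<cdot> (ident C (unit_obj C) \<odot> f) = f \<cdot> left_unitor C A"
    and right_unitor_iso: "A \<in> obj C \<Longrightarrow> right_unitor C A \<in> iso C (A \<otimes> unit_obj C) A"
    and right_unitor_natural: "f \<in> hom C A B
      \<Longrightarrow> right_unitor C B \<cdot> (f \<odot> ident C (unit_obj C)) = f \<cdot> right_unitor C A"
    and braiding_hom: "\<lbrakk>A \<in> obj C; B \<in> obj C\<rbrakk> \<Longrightarrow> braiding C A B \<in> hom C (A \<otimes> B) (B \<otimes> A)"
    and braiding_natural: "\<lbrakk>f \<in> hom C A A'; g \<in> hom C B B'\<rbrakk>
      \<Longrightarrow> braiding C A' B' \<cdot> (f \<odot> g) = (g \<odot> f) \<cdot> braiding C A B"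
    and braiding_symmetric: "\<lbrakk>A \<in> obj C; B \<in> obj C\<rbrakk>
      \<Longrightarrow> braiding C B A \<cdot> braiding C A B = ident C (A \<otimes> B)"
    and triangle: "\<lbrakk>A \<in> obj C; B \<in> obj C\<rbrakk>
      \<Longrightarrow> (ident C A \<odot> left_unitor C B) \<cdot> associator C A (unit_obj C) B
        = right_unitor C A \<odot> ident C B"
    and pentagon: "\<lbrakk>A \<in> obj C; B \<in> obj C; D \<in> obj C; E \<in> obj C\<rbrakk>
      \<Longrightarrow> (ident C A \<odot> associator C B D E) \<cdot> associator C A (B \<otimes> D) E
            \<cdot> (associator C A B D \<odot> ident C E)
        = associator C A B (D \<otimes> E) \<cdot> associator C (A \<otimes> B) D E"
    and hexagon: "\<lbrakk>A \<in> obj C; B \<in> obj C; D \<in> obj C\<rbrakk>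
      \<Longrightarrow> associator C B D A \<cdot> braiding C A (B \<otimes> D) \<cdot> associator C A B D
        = (ident C B \<odot> braiding C A D) \<cdot> associator C B A D \<cdot> (braiding C A B \<odot> ident C D)"


section \<open>Lax symmetric monoidal functors to sets, and monoidal transformations\<close>

text \<open>
  The target category is the Cartesian monoidal category of sets, realised by HOL sets,
  extensional functions, binary products of HOL types and the one-element type \<open>unit\<close>; its
  structural isomorphisms are not named, so the coherence axioms are stated on elements.
\<close>

record ('o, 'm, 'b) set_functor =
  on_obj :: "'o \<Rightarrow> 'b set"
  on_arr :: "'m \<Rightarrow> 'b \<Rightarrow> 'b"
  prod_comparison :: "'o \<Rightarrow> 'o \<Rightarrow> 'b \<times> 'b \<Rightarrow> 'b"
  unit_comparison :: "unit \<Rightarrow> 'b"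

locale lax_symmetric_monoidal_functor = symmetric_monoidal_category C
  for C :: "('o, 'm) sym_mon_category" (structure) +
  fixes F :: "('o, 'm, 'b) set_functor"
  assumes on_arr_hom: "f \<in> hom C A B \<Longrightarrow> on_arr F f \<in> on_obj F A \<rightarrow>\<^sub>E on_obj F B"
    and on_arr_ident: "\<lbrakk>A \<in> obj C; x \<in> on_obj F A\<rbrakk> \<Longrightarrow> on_arr F (ident C A) x = x"
    and on_arr_comp: "\<lbrakk>f \<in> hom C A B; g \<in> hom C B D; x \<in> on_obj F A\<rbrakk>
      \<Longrightarrow> on_arr F (g \<cdot> f) x = on_arr F g (on_arr F f x)"
    and prod_comparison_hom: "\<lbrakk>A \<in> obj C; B \<in> obj C\<rbrakk>
      \<Longrightarrow> prod_comparison F A B \<in> on_obj F A \<times> on_obj F B \<rightarrow>\<^sub>E on_obj F (A \<otimes> B)"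
    and unit_comparison_hom: "unit_comparison F \<in> UNIV \<rightarrow>\<^sub>E on_obj F (unit_obj C)"
    and prod_comparison_natural:
      "\<lbrakk>f \<in> hom C A A'; g \<in> hom C B B'; x \<in> on_obj F A; y \<in> on_obj F B\<rbrakk>
      \<Longrightarrow> on_arr F (f \<odot> g) (prod_comparison F A B (x, y))
        = prod_comparison F A' B' (on_arr F f x, on_arr F g y)"
    and lax_associativity:
      "\<lbrakk>A \<in> obj C; B \<in> obj C; D \<in> obj C; x \<in> on_obj F A; y \<in> on_obj F B; z \<in> on_obj F D\<rbrakk>
      \<Longrightarrow> on_arr F (associator C A B D)
            (prod_comparison F (A \<otimes> B) D (prod_comparison F A B (x, y), z))
        = prod_comparison F A (B \<otimes> D) (x, prod_comparison F B D (y, z))"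
    and lax_left_unit: "\<lbrakk>A \<in> obj C; x \<in> on_obj F A\<rbrakk>
      \<Longrightarrow> on_arr F (left_unitor C A) (prod_comparison F (unit_obj C) A (unit_comparison F (), x)) = x"
    and lax_right_unit: "\<lbrakk>A \<in> obj C; x \<in> on_obj F A\<rbrakk>
      \<Longrightarrow> on_arr F (right_unitor C A) (prod_comparison F A (unit_obj C) (x, unit_comparison F ())) = x"
    and lax_symmetry: "\<lbrakk>A \<in> obj C; B \<in> obj C; x \<in> on_obj F A; y \<in> on_obj F B\<rbrakk>
      \<Longrightarrow> on_arr F (braiding C A B) (prod_comparison F A B (x, y)) = prod_comparison F B A (y, x)"

locale monoidal_natural_transformation =
  F: lax_symmetric_monoidal_functor C F + G: lax_symmetric_monoidal_functor C G
  for C :: "('o, 'm) sym_mon_category" (structure)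
    and F :: "('o, 'm, 'b) set_functor" and G :: "('o, 'm, 'c) set_functor" +
  fixes \<eta> :: "'o \<Rightarrow> 'b \<Rightarrow> 'c"
  assumes component_hom: "A \<in> obj C \<Longrightarrow> \<eta> A \<in> on_obj F A \<rightarrow>\<^sub>E on_obj G A"
    and natural: "\<lbrakk>f \<in> hom C A B; x \<in> on_obj F A\<rbrakk>
      \<Longrightarrow> \<eta> B (on_arr F f x) = on_arr G f (\<eta> A x)"
    and monoidal_prod: "\<lbrakk>A \<in> obj C; B \<in> obj C; x \<in> on_obj F A; y \<in> on_obj F B\<rbrakk>
      \<Longrightarrow> \<eta> (A \<otimes> B) (prod_comparison F A B (x, y)) = prod_comparison G A B (\<eta> A x, \<eta> B y)"
    and monoidal_unit: "\<eta> (unit_obj C) (unit_comparison F ()) = unit_comparison G ()"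


section \<open>Finite sets under disjoint union\<close>

text \<open>
  Finite sets have to be drawn from one type that is closed under binary disjoint union.
  \<open>'a tagged\<close> is the free such type over an arbitrary type \<open>'a\<close>: a finite set
  \<open>S :: 'a set\<close> appears as \<open>Atom ` S\<close>.
\<close>

datatype 'a tagged = Atom 'a | InL "'a tagged" | InR "'a tagged"

definition disjoint_union :: "'a tagged set \<Rightarrow> 'a tagged set \<Rightarrow> 'a tagged set"
  (infixr "\<uplus>" 65) where
  "N \<uplus> M = InL ` N \<union> InR ` M"

record 'a finmap =
  src :: "'a tagged set"
  tgt :: "'a tagged set"
  app :: "'a tagged \<Rightarrow> 'a tagged"

definition mk_finmap :: "'a tagged set \<Rightarrow> 'a tagged set \<Rightarrow> ('a tagged \<Rightarrow> 'a tagged) \<Rightarrow> 'a finmap" where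
  "mk_finmap N M f = \<lparr>src = N, tgt = M, app = restrict f N\<rparr>"

definition inclL :: "'a tagged set \<Rightarrow> 'a tagged set \<Rightarrow> 'a finmap" where
  "inclL N M = mk_finmap N (N \<uplus> M) InL"

definition inclR :: "'a tagged set \<Rightarrow> 'a tagged set \<Rightarrow> 'a finmap" where
  "inclR N M = mk_finmap M (N \<uplus> M) InR"

text \<open>
  In the following maps \<open>Atom\<close> and the other omitted patterns lie outside the domains.
\<close>

fun map_tagged_sum ::
  "('a tagged \<Rightarrow> 'a tagged) \<Rightarrow> ('a tagged \<Rightarrow> 'a tagged) \<Rightarrow> 'a tagged \<Rightarrow> 'a tagged" where
  "map_tagged_sum f g (InL i) = InL (f i)"
| "map_tagged_sum f g (InR j) = InR (g j)"
| "map_tagged_sum f g (Atom a) = undefined"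

fun reassoc :: "'a tagged \<Rightarrow> 'a tagged" where
  "reassoc (InL (InL i)) = InL i"
| "reassoc (InL (InR j)) = InR (InL j)"
| "reassoc (InR k) = InR (InR k)"
| "reassoc _ = undefined"

fun untag :: "'a tagged \<Rightarrow> 'a tagged" where
  "untag (InL i) = i"
| "untag (InR j) = j"
| "untag (Atom a) = undefined"

fun swap_tags :: "'a tagged \<Rightarrow> 'a tagged" where
  "swap_tags (InL i) = InR i"
| "swap_tags (InR j) = InL j"
| "swap_tags (Atom a) = undefined"

definition FinSet :: "('a tagged set, 'a finmap) sym_mon_category" where
  "FinSet = \<lparr>
     obj = {N. finite N},
     arr = {\<phi>. finite (src \<phi>) \<and> finite (tgt \<phi>) \<and> app \<phi> \<in> src \<phi> \<rightarrow>\<^sub>E tgt \<phi>},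
     source = src,
     target = tgt,
     ident = (\<lambda>N. mk_finmap N N (\<lambda>i. i)),
     comp = (\<lambda>\<psi> \<phi>. mk_finmap (src \<phi>) (tgt \<psi>) (app \<psi> \<circ> app \<phi>)),
     tensor_obj = (\<uplus>),
     tensor_arr = (\<lambda>\<phi> \<psi>. mk_finmap (src \<phi> \<uplus> src \<psi>) (tgt \<phi> \<uplus> tgt \<psi>)
                          (map_tagged_sum (app \<phi>) (app \<psi>))),
     unit_obj = {},
     associator = (\<lambda>N M P. mk_finmap ((N \<uplus> M) \<uplus> P) (N \<uplus> (M \<uplus> P)) reassoc),
     left_unitor = (\<lambda>N. mk_finmap ({} \<uplus> N) N untag),
     right_unitor = (\<lambda>N. mk_finmap (N \<uplus> {}) N untag),
     braiding = (\<lambda>N M. mk_finmap (N \<uplus> M) (M \<uplus> N) swap_tags)\<rparr>"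


section \<open>The vector spaces of real functions on a finite set\<close>

text \<open>
  \<open>real_vecs N\<close> is \<open>\<real>\<close> to the power \<open>N\<close>, with vectors as extensional functions. As a subspace of the
  function type \<open>'a tagged \<Rightarrow> real\<close>, whose topology is the product topology, it carries its
  Euclidean topology.
\<close>

definition real_vecs :: "'a tagged set \<Rightarrow> ('a tagged \<Rightarrow> real) set" where
  "real_vecs N = N \<rightarrow>\<^sub>E UNIV"

definition vadd :: "'a tagged set \<Rightarrow> ('a tagged \<Rightarrow> real) \<Rightarrow> ('a tagged \<Rightarrow> real) \<Rightarrow> 'a tagged \<Rightarrow> real" where
  "vadd N x y = (\<lambda>i\<in>N. x i + y i)"

definition vsub :: "'a tagged set \<Rightarrow> ('a tagged \<Rightarrow> real) \<Rightarrow> ('a tagged \<Rightarrow> real) \<Rightarrow> 'a tagged \<Rightarrow> real" where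
  "vsub N x y = (\<lambda>i\<in>N. x i - y i)"

definition vscale :: "'a tagged set \<Rightarrow> real \<Rightarrow> ('a tagged \<Rightarrow> real) \<Rightarrow> 'a tagged \<Rightarrow> real" where
  "vscale N c x = (\<lambda>i\<in>N. c * x i)"

definition pullback :: "'a finmap \<Rightarrow> ('a tagged \<Rightarrow> real) \<Rightarrow> 'a tagged \<Rightarrow> real" where
  "pullback \<phi> = (\<lambda>y\<in>real_vecs (tgt \<phi>). \<lambda>i\<in>src \<phi>. y (app \<phi> i))"

definition pushforward :: "'a finmap \<Rightarrow> ('a tagged \<Rightarrow> real) \<Rightarrow> 'a tagged \<Rightarrow> real" where
  "pushforward \<phi> = (\<lambda>x\<in>real_vecs (src \<phi>). \<lambda>j\<in>tgt \<phi>. \<Sum>i | i \<in> src \<phi> \<and> app \<phi> i = j. x i)"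


section \<open>The functor Opt\<close>

definition partial_deriv ::
  "(('a tagged \<Rightarrow> real) \<Rightarrow> real) \<Rightarrow> 'a tagged \<Rightarrow> ('a tagged \<Rightarrow> real) \<Rightarrow> real" where
  "partial_deriv f i x = deriv (\<lambda>t. f (x(i := t))) (x i)"

text \<open>Continuous differentiability: all partial derivatives exist and are continuous.\<close>

definition C1 :: "'a tagged set \<Rightarrow> (('a tagged \<Rightarrow> real) \<Rightarrow> real) \<Rightarrow> bool" where
  "C1 N f \<longleftrightarrow> (\<forall>i\<in>N.
     (\<forall>x\<in>real_vecs N. (\<lambda>t. f (x(i := t))) differentiable (at (x i))) \<and>
     continuous_on (real_vecs N) (partial_deriv f i))"

definition grad ::
  "'a tagged set \<Rightarrow> (('a tagged \<Rightarrow> real) \<Rightarrow> real) \<Rightarrow> ('a tagged \<Rightarrow> real) \<Rightarrow> 'a tagged \<Rightarrow> real" where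
  "grad N f = (\<lambda>x\<in>real_vecs N. \<lambda>i\<in>N. partial_deriv f i x)"

definition Opt_obj :: "'a tagged set \<Rightarrow> (('a tagged \<Rightarrow> real) \<Rightarrow> real) set" where
  "Opt_obj N = {f \<in> real_vecs N \<rightarrow>\<^sub>E UNIV. C1 N f}"

definition Opt :: "('a tagged set, 'a finmap, ('a tagged \<Rightarrow> real) \<Rightarrow> real) set_functor" where
  "Opt = \<lparr>
     on_obj = Opt_obj,
     on_arr = (\<lambda>\<phi>. \<lambda>f\<in>Opt_obj (src \<phi>). \<lambda>y\<in>real_vecs (tgt \<phi>). f (pullback \<phi> y)),
     prod_comparison = (\<lambda>N M. \<lambda>(f, g)\<in>Opt_obj N \<times> Opt_obj M.
       \<lambda>z\<in>real_vecs (N \<uplus> M). f (pullback (inclL N M) z) + g (pullback (inclR N M) z)),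
     unit_comparison = (\<lambda>_. \<lambda>z\<in>real_vecs {}. 0)\<rparr>"


section \<open>The functor of discrete dynamical systems\<close>

definition Dynam_obj :: "'a tagged set \<Rightarrow> (('a tagged \<Rightarrow> real) \<Rightarrow> ('a tagged \<Rightarrow> real)) set" where
  "Dynam_obj N = real_vecs N \<rightarrow>\<^sub>E real_vecs N"

text \<open>The unit comparison picks the only element of \<open>Dynam_obj {}\<close>, the identity.\<close>

definition Dynam ::
  "('a tagged set, 'a finmap, ('a tagged \<Rightarrow> real) \<Rightarrow> ('a tagged \<Rightarrow> real)) set_functor" where
  "Dynam = \<lparr>
     on_obj = Dynam_obj,
     on_arr = (\<lambda>\<phi>. \<lambda>\<upsilon>\<in>Dynam_obj (src \<phi>). \<lambda>y\<in>real_vecs (tgt \<phi>).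
       vadd (tgt \<phi>) y
         (pushforward \<phi> (vsub (src \<phi>) (\<upsilon> (pullback \<phi> y)) (pullback \<phi> y)))),
     prod_comparison = (\<lambda>N M. \<lambda>(\<upsilon>, \<rho>)\<in>Dynam_obj N \<times> Dynam_obj M.
       \<lambda>z\<in>real_vecs (N \<uplus> M).
         vadd (N \<uplus> M) (pushforward (inclL N M) (\<upsilon> (pullback (inclL N M) z)))
                      (pushforward (inclR N M) (\<rho> (pullback (inclR N M) z)))),
     unit_comparison = (\<lambda>_. \<lambda>z\<in>real_vecs {}. z)\<rparr>"

end

theory Submission
  imports Defs
begin

text \<open>
  The heart of the matter is the chain rule. For a map \<open>\<phi>\<close> from \<open>N\<close> to \<open>M\<close>, precomposing \<open>f\<close> with
  the pullback along \<open>\<phi>\<close> produces a function whose gradient at \<open>y\<close> is the pushforward of the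
  gradient of \<open>f\<close> at the pullback of \<open>y\<close>, since pushforward is the transpose of pullback
  (\<open>grad_Opt_on_arr\<close>). A discrete dynamical system \<open>\<upsilon>\<close> is transported along \<open>\<phi>\<close> by placing
  its displacement \<open>\<upsilon> - id\<close> between exactly these two linear maps, and gradient descent is the system
  with displacement \<open>- \<gamma> \<nabla>f\<close>; so naturality is the chain rule multiplied by \<open>- \<gamma>\<close>
  (\<open>gradient_step_natural\<close>). The product comparisons are handled in the same way: the one for
  functions is a sum of pullbacks along the two inclusions, and its gradient on each summand is
  the gradient of the corresponding function (\<open>gradient_step_prod\<close>).

  Differentiability is given by continuous partial derivatives. Instead of passing to a total
  derivative, the proof differentiates along the only curves that occur, on which the coordinates in
  a fibre of \<open>\<phi>\<close> move simultaneously, by induction on the size of the fibre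
  (\<open>C1_DERIV_set_coords\<close>). This also shows that the functor of differentiable functions is well
  defined on arrows.

  A monoidal transformation further presupposes that finite sets form a symmetric monoidal
  category and that both functors are lax symmetric monoidal. For finite sets and for functions
  these are computations with explicit maps. For dynamical systems, an arrow acts through sums over
  fibres; along the structural bijections every fibre is a single point
  (\<open>Dynam_on_arr_bij\<close>), and naturality of the product comparison holds because fibres of
  \<open>\<phi> + \<psi>\<close> are fibres of \<open>\<phi>\<close> or of \<open>\<psi>\<close> (\<open>Dynam_prod_natural\<close>).
\<close>


section \<open>Finite sets under disjoint union\<close>

lemma mk_finmap_sel [simp]:
  "src (mk_finmap N M f) = N" "tgt (mk_finmap N M f) = M" "app (mk_finmap N M f) = restrict f N"
  by (simp_all add: mk_finmap_def)

lemma mk_finmap_cong: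
  assumes "\<And>i. i \<in> N \<Longrightarrow> f i = g i"
  shows "mk_finmap N M f = mk_finmap N M g"
  using assms by (auto simp: mk_finmap_def intro: restrict_ext)

lemma FinSet_obj [simp]: "N \<in> obj FinSet \<longleftrightarrow> finite N"
  by (simp add: FinSet_def)

lemma FinSet_hom_iff:
  "\<phi> \<in> hom FinSet N M \<longleftrightarrow>
     finite N \<and> finite M \<and> src \<phi> = N \<and> tgt \<phi> = M \<and> app \<phi> \<in> N \<rightarrow>\<^sub>E M"
  by (auto simp: hom_def FinSet_def)

lemma mk_finmap_hom:
  "\<lbrakk>finite N; finite M; f \<in> N \<rightarrow> M\<rbrakk> \<Longrightarrow> mk_finmap N M f \<in> hom FinSet N M"
  by (auto simp: FinSet_hom_iff)

text \<open>
  With this elimination every equation between arrows becomes an equation between explicit maps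
  under \<open>mk_finmap\<close>, and \<open>mk_finmap_cong\<close> reduces it to elements of a disjoint union, where all
  structural maps compute.
\<close>

lemma FinSet_homE:
  assumes "\<phi> \<in> hom FinSet N M"
  obtains f where "\<phi> = mk_finmap N M f" "f \<in> N \<rightarrow> M" "finite N" "finite M"
proof
  show "\<phi> = mk_finmap N M (app \<phi>)"
    using assms by (cases \<phi>) (auto simp: FinSet_hom_iff mk_finmap_def PiE_restrict)
qed (use assms in \<open>auto simp: FinSet_hom_iff\<close>)

lemma FinSet_ident [simp]: "ident FinSet N = mk_finmap N N (\<lambda>i. i)"
  and FinSet_tensor_obj [simp]: "tensor_obj FinSet N M = N \<uplus> M"
  and FinSet_unit_obj [simp]: "unit_obj FinSet = {}"
  and FinSet_associator [simp]:
    "associator FinSet N M P = mk_finmap ((N \<uplus> M) \<uplus> P) (N \<uplus> (M \<uplus> P)) reassoc"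
  and FinSet_left_unitor [simp]: "left_unitor FinSet N = mk_finmap ({} \<uplus> N) N untag"
  and FinSet_right_unitor [simp]: "right_unitor FinSet N = mk_finmap (N \<uplus> {}) N untag"
  and FinSet_braiding [simp]: "braiding FinSet N M = mk_finmap (N \<uplus> M) (M \<uplus> N) swap_tags"
  by (simp_all add: FinSet_def)

lemma FinSet_comp [simp]:
  "f \<in> N \<rightarrow> M \<Longrightarrow> comp FinSet (mk_finmap M P g) (mk_finmap N M f) = mk_finmap N P (\<lambda>i. g (f i))"
  by (auto simp: FinSet_def intro!: mk_finmap_cong)

lemma in_disjoint_union [simp]:
  "InL i \<in> N \<uplus> M \<longleftrightarrow> i \<in> N" "InR i \<in> N \<uplus> M \<longleftrightarrow> i \<in> M" "Atom a \<notin> N \<uplus> M"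
  by (auto simp: disjoint_union_def)

lemma disjoint_unionE:
  assumes "k \<in> N \<uplus> M"
  obtains i where "k = InL i" "i \<in> N" | j where "k = InR j" "j \<in> M"
  using assms by (auto simp: disjoint_union_def)

lemma finite_disjoint_union [simp]: "\<lbrakk>finite N; finite M\<rbrakk> \<Longrightarrow> finite (N \<uplus> M)"
  by (simp add: disjoint_union_def)

lemma FinSet_tensor [simp]:
  "tensor_arr FinSet (mk_finmap N M f) (mk_finmap N' M' g) =
     mk_finmap (N \<uplus> N') (M \<uplus> M') (map_tagged_sum f g)"
  by (auto simp: FinSet_def intro!: mk_finmap_cong elim!: disjoint_unionE)

lemma disjoint_union_Pi [intro]:
  "\<lbrakk>f \<in> N \<rightarrow> M; g \<in> N' \<rightarrow> M'\<rbrakk> \<Longrightarrow> map_tagged_sum f g \<in> N \<uplus> N' \<rightarrow> M \<uplus> M'"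
  "reassoc \<in> (N \<uplus> M) \<uplus> P \<rightarrow> N \<uplus> (M \<uplus> P)"
  "untag \<in> {} \<uplus> N \<rightarrow> N"
  "untag \<in> N \<uplus> {} \<rightarrow> N"
  "swap_tags \<in> N \<uplus> M \<rightarrow> M \<uplus> N"
  "InL \<in> N \<rightarrow> N \<uplus> M"
  "InR \<in> M \<rightarrow> N \<uplus> M"
  by (auto elim!: disjoint_unionE)

lemma mk_finmap_iso:
  assumes "finite N" "bij_betw f N M"
  shows "mk_finmap N M f \<in> iso FinSet N M"
proof -
  let ?g = "inv_into N f"
  have M: "finite M"
    using assms bij_betw_finite by blast
  have f: "f \<in> N \<rightarrow> M"
    using assms(2) by (rule bij_betw_imp_funcset)
  have g: "?g \<in> M \<rightarrow> N"
    using assms(2) by (intro bij_betw_imp_funcset bij_betw_inv_into)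
  show ?thesis
    unfolding iso_def
  proof (intro CollectI conjI bexI)
    show "mk_finmap N M f \<in> hom FinSet N M" "mk_finmap M N ?g \<in> hom FinSet M N"
      using assms(1) M f g by (simp_all add: mk_finmap_hom)
    show "comp FinSet (mk_finmap M N ?g) (mk_finmap N M f) = ident FinSet N"
      using f bij_betw_inv_into_left[OF assms(2)] by (auto intro!: mk_finmap_cong)
    show "comp FinSet (mk_finmap N M f) (mk_finmap M N ?g) = ident FinSet M"
      using g bij_betw_inv_into_right[OF assms(2)] by (auto intro!: mk_finmap_cong)
  qed
qed

lemma structural_bijections:
  "bij_betw reassoc ((N \<uplus> M) \<uplus> P) (N \<uplus> (M \<uplus> P))"
  "bij_betw untag ({} \<uplus> N) N"
  "bij_betw untag (N \<uplus> {}) N"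
  "bij_betw swap_tags (N \<uplus> M) (M \<uplus> N)"
proof -
  show "bij_betw reassoc ((N \<uplus> M) \<uplus> P) (N \<uplus> (M \<uplus> P))"
    by (rule bij_betwI[where g = "\<lambda>k. case k of InL i \<Rightarrow> InL (InL i) | InR (InL j) \<Rightarrow> InL (InR j)
          | InR (InR l) \<Rightarrow> InR l"])
      (auto elim!: disjoint_unionE)
  show "bij_betw untag ({} \<uplus> N) N"
    by (rule bij_betwI[where g = InR]) (auto elim!: disjoint_unionE)
  show "bij_betw untag (N \<uplus> {}) N"
    by (rule bij_betwI[where g = InL]) (auto elim!: disjoint_unionE)
  show "bij_betw swap_tags (N \<uplus> M) (M \<uplus> N)"
    by (rule bij_betwI[where g = swap_tags]) (auto elim!: disjoint_unionE)
qed

lemma Pi_compose: "\<lbrakk>f \<in> N \<rightarrow> M; g \<in> M \<rightarrow> P\<rbrakk> \<Longrightarrow> (\<lambda>i. g (f i)) \<in> N \<rightarrow> P"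
  by auto

theorem symmetric_monoidal_FinSet:
  "symmetric_monoidal_category (FinSet :: ('a tagged set, 'a finmap) sym_mon_category)"
proof (rule symmetric_monoidal_category.intro, goal_cases source_obj target_obj ident_hom comp_hom
    comp_ident ident_comp comp_assoc unit_obj tensor_obj tensor_hom tensor_ident tensor_comp
    associator_iso associator_natural left_unitor_iso left_unitor_natural right_unitor_iso
    right_unitor_natural braiding_hom braiding_natural braiding_symmetric triangle pentagon hexagon)
  case (source_obj \<phi>)
  then show ?case by (simp add: FinSet_def)
next
  case (target_obj \<phi>)
  then show ?case by (simp add: FinSet_def)
next
  case (ident_hom N)
  then show ?case by (auto intro: mk_finmap_hom)
next
  case (comp_hom \<phi> N M \<psi> P)
  then show ?case by (elim FinSet_homE) (simp add: mk_finmap_hom Pi_compose)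
next
  case (comp_ident \<phi> N M)
  then show ?case by (elim FinSet_homE) simp
next
  case (ident_comp \<phi> N M)
  then show ?case by (elim FinSet_homE) simp
next
  case (comp_assoc \<phi> N M \<psi> P \<chi> Q)
  then show ?case by (elim FinSet_homE) (simp add: Pi_compose)
next
  case unit_obj
  then show ?case by simp
next
  case (tensor_obj N M)
  then show ?case by simp
next
  case (tensor_hom \<phi> N N' \<psi> M M')
  then show ?case by (elim FinSet_homE) (simp add: mk_finmap_hom disjoint_union_Pi)
next
  case (tensor_ident N M)
  then show ?case by (auto intro!: mk_finmap_cong elim!: disjoint_unionE)
next
  case (tensor_comp \<phi> N N' \<phi>' N'' \<psi> M M' \<psi>' M'')
  then show ?case
    by (elim FinSet_homE)
      (auto simp: disjoint_union_Pi intro!: mk_finmap_cong elim!: disjoint_unionE)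
next
  case (associator_iso N M P)
  then show ?case by (simp add: mk_finmap_iso structural_bijections)
next
  case (associator_natural \<phi> N N' \<psi> M M' \<chi> P P')
  then show ?case
    by (elim FinSet_homE)
      (auto simp: disjoint_union_Pi intro!: mk_finmap_cong elim!: disjoint_unionE)
next
  case (left_unitor_iso N)
  then show ?case by (simp add: mk_finmap_iso structural_bijections)
next
  case (left_unitor_natural \<phi> N M)
  then show ?case
    by (elim FinSet_homE)
      (auto simp: disjoint_union_Pi intro!: mk_finmap_cong elim!: disjoint_unionE)
next
  case (right_unitor_iso N)
  then show ?case by (simp add: mk_finmap_iso structural_bijections)
next
  case (right_unitor_natural \<phi> N M)
  then show ?case
    by (elim FinSet_homE)
      (auto simp: disjoint_union_Pi intro!: mk_finmap_cong elim!: disjoint_unionE)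
next
  case (braiding_hom N M)
  then show ?case by (simp add: mk_finmap_hom disjoint_union_Pi)
next
  case (braiding_natural \<phi> N N' \<psi> M M')
  then show ?case
    by (elim FinSet_homE)
      (auto simp: disjoint_union_Pi intro!: mk_finmap_cong elim!: disjoint_unionE)
next
  case (braiding_symmetric N M)
  then show ?case
    by (auto simp: disjoint_union_Pi intro!: mk_finmap_cong elim!: disjoint_unionE)
next
  case (triangle N M)
  then show ?case
    by (auto simp: disjoint_union_Pi intro!: mk_finmap_cong elim!: disjoint_unionE)
next
  case (pentagon N M P Q)
  \<comment> \<open>Computing the composite of two explicit maps requires that the inner one, here itself a
    composite, is known to land in its target.\<close>
  have "(\<lambda>i. reassoc (map_tagged_sum reassoc (\<lambda>i. i) i))
      \<in> ((N \<uplus> M) \<uplus> P) \<uplus> Q \<rightarrow> N \<uplus> ((M \<uplus> P) \<uplus> Q)"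
    by (auto elim!: disjoint_unionE)
  then show ?case
    by (auto simp: disjoint_union_Pi intro!: mk_finmap_cong elim!: disjoint_unionE)
next
  case (hexagon N M P)
  have "(\<lambda>i. swap_tags (reassoc i)) \<in> (N \<uplus> M) \<uplus> P \<rightarrow> (M \<uplus> P) \<uplus> N"
    and "(\<lambda>i. reassoc (map_tagged_sum swap_tags (\<lambda>i. i) i)) \<in> (N \<uplus> M) \<uplus> P \<rightarrow> M \<uplus> (N \<uplus> P)"
    by (auto elim!: disjoint_unionE)
  then show ?case
    by (auto simp: disjoint_union_Pi intro!: mk_finmap_cong elim!: disjoint_unionE)
qed

lemma structural_homs:
  "\<lbrakk>finite N; finite M; finite P\<rbrakk> \<Longrightarrow>
    mk_finmap ((N \<uplus> M) \<uplus> P) (N \<uplus> (M \<uplus> P)) reassoc \<in> hom FinSet ((N \<uplus> M) \<uplus> P) (N \<uplus> (M \<uplus> P))"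
  "finite N \<Longrightarrow> mk_finmap ({} \<uplus> N) N untag \<in> hom FinSet ({} \<uplus> N) N"
  "finite N \<Longrightarrow> mk_finmap (N \<uplus> {}) N untag \<in> hom FinSet (N \<uplus> {}) N"
  "\<lbrakk>finite N; finite M\<rbrakk> \<Longrightarrow> mk_finmap (N \<uplus> M) (M \<uplus> N) swap_tags \<in> hom FinSet (N \<uplus> M) (M \<uplus> N)"
  by (simp_all add: mk_finmap_hom disjoint_union_Pi)

lemma tensor_arr_hom:
  "\<lbrakk>\<phi> \<in> hom FinSet N N'; \<psi> \<in> hom FinSet M M'\<rbrakk>
    \<Longrightarrow> tensor_arr FinSet \<phi> \<psi> \<in> hom FinSet (N \<uplus> M) (N' \<uplus> M')"
  using symmetric_monoidal_category.tensor_hom[OF symmetric_monoidal_FinSet] by fastforce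

lemma FinSet_comp_hom:
  "\<lbrakk>\<phi> \<in> hom FinSet N M; \<psi> \<in> hom FinSet M P\<rbrakk> \<Longrightarrow> comp FinSet \<psi> \<phi> \<in> hom FinSet N P"
  by (rule symmetric_monoidal_category.comp_hom[OF symmetric_monoidal_FinSet])

lemma inclL_hom: "\<lbrakk>finite N; finite M\<rbrakk> \<Longrightarrow> inclL N M \<in> hom FinSet N (N \<uplus> M)"
  and inclR_hom: "\<lbrakk>finite N; finite M\<rbrakk> \<Longrightarrow> inclR N M \<in> hom FinSet M (N \<uplus> M)"
  by (simp_all add: inclL_def inclR_def mk_finmap_hom disjoint_union_Pi)


section \<open>Pullback and pushforward of vectors\<close>

lemma real_vecs_eqI:
  "\<lbrakk>x \<in> real_vecs N; y \<in> real_vecs N; \<And>i. i \<in> N \<Longrightarrow> x i = y i\<rbrakk> \<Longrightarrow> x = y"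
  unfolding real_vecs_def by (rule PiE_ext)

lemma restrict_in_real_vecs [simp]: "restrict x N \<in> real_vecs N"
  by (simp add: real_vecs_def)

lemma fun_upd_in_real_vecs [simp]: "\<lbrakk>x \<in> real_vecs N; i \<in> N\<rbrakk> \<Longrightarrow> x(i := t) \<in> real_vecs N"
  by (auto simp: real_vecs_def PiE_def extensional_def)

lemma real_vecs_restrict_id: "y \<in> real_vecs N \<Longrightarrow> (\<lambda>i\<in>N. y i) = y"
  by (simp add: real_vecs_def PiE_restrict)

lemma vec_ops_in_real_vecs [simp]:
  "vadd N x y \<in> real_vecs N" "vsub N x y \<in> real_vecs N" "vscale N c x \<in> real_vecs N"
  by (simp_all add: vadd_def vsub_def vscale_def)

lemma vec_ops_nth [simp]:
  assumes "i \<in> N"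
  shows "vadd N x y i = x i + y i" "vsub N x y i = x i - y i" "vscale N c x i = c * x i"
  using assms by (simp_all add: vadd_def vsub_def vscale_def)

lemma pullback_mk:
  "\<lbrakk>f \<in> N \<rightarrow> M; y \<in> real_vecs M\<rbrakk> \<Longrightarrow> pullback (mk_finmap N M f) y = (\<lambda>i\<in>N. y (f i))"
  by (auto simp: pullback_def)

lemma pullback_hom:
  "\<lbrakk>\<phi> \<in> hom FinSet N M; y \<in> real_vecs M\<rbrakk> \<Longrightarrow> pullback \<phi> y = (\<lambda>i\<in>N. y (app \<phi> i))"
  by (auto simp: pullback_def FinSet_hom_iff)

lemma pushforward_hom:
  "\<lbrakk>\<phi> \<in> hom FinSet N M; x \<in> real_vecs N\<rbrakk>
    \<Longrightarrow> pushforward \<phi> x = (\<lambda>j\<in>M. \<Sum>i | i \<in> N \<and> app \<phi> i = j. x i)"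
  by (auto simp: pushforward_def FinSet_hom_iff)

lemma pullback_in_real_vecs:
  "\<lbrakk>\<phi> \<in> hom FinSet N M; y \<in> real_vecs M\<rbrakk> \<Longrightarrow> pullback \<phi> y \<in> real_vecs N"
  by (simp add: pullback_hom)

lemma pushforward_in_real_vecs:
  "\<lbrakk>\<phi> \<in> hom FinSet N M; x \<in> real_vecs N\<rbrakk> \<Longrightarrow> pushforward \<phi> x \<in> real_vecs M"
  by (simp add: pushforward_hom)

lemma pullback_inclL: "z \<in> real_vecs (N \<uplus> M) \<Longrightarrow> pullback (inclL N M) z = (\<lambda>i\<in>N. z (InL i))"
  and pullback_inclR: "z \<in> real_vecs (N \<uplus> M) \<Longrightarrow> pullback (inclR N M) z = (\<lambda>j\<in>M. z (InR j))"
  by (simp_all add: inclL_def inclR_def pullback_mk disjoint_union_Pi)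

lemma pullback_ident: "y \<in> real_vecs N \<Longrightarrow> pullback (ident FinSet N) y = y"
  by (rule real_vecs_eqI[of _ N]) (auto simp: pullback_mk)

lemma pullback_comp:
  "\<lbrakk>\<phi> \<in> hom FinSet N M; \<psi> \<in> hom FinSet M P; y \<in> real_vecs P\<rbrakk>
    \<Longrightarrow> pullback (comp FinSet \<psi> \<phi>) y = pullback \<phi> (pullback \<psi> y)"
  by (elim FinSet_homE) (auto simp: pullback_mk Pi_compose intro!: restrict_ext)

lemma pullback_tensor_arr:
  assumes "\<phi> \<in> hom FinSet N N'" "\<psi> \<in> hom FinSet M M'" "z \<in> real_vecs (N' \<uplus> M')"
  shows "pullback (inclL N M) (pullback (tensor_arr FinSet \<phi> \<psi>) z) = pullback \<phi> (pullback (inclL N' M') z)"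
    and "pullback (inclR N M) (pullback (tensor_arr FinSet \<phi> \<psi>) z) = pullback \<psi> (pullback (inclR N' M') z)"
proof -
  obtain f g where \<phi>: "\<phi> = mk_finmap N N' f" "f \<in> N \<rightarrow> N'" and \<psi>: "\<psi> = mk_finmap M M' g" "g \<in> M \<rightarrow> M'"
    using assms(1,2) by (elim FinSet_homE)
  have "f i \<in> N'" if "i \<in> N" for i
    using \<phi> that by auto
  moreover have "g j \<in> M'" if "j \<in> M" for j
    using \<psi> that by auto
  ultimately show
    "pullback (inclL N M) (pullback (tensor_arr FinSet \<phi> \<psi>) z) = pullback \<phi> (pullback (inclL N' M') z)"
    "pullback (inclR N M) (pullback (tensor_arr FinSet \<phi> \<psi>) z) = pullback \<psi> (pullback (inclR N' M') z)"
    using assms(3) \<phi> \<psi>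
    by (auto simp: pullback_mk pullback_inclL pullback_inclR disjoint_union_Pi intro!: restrict_ext)
qed

lemma pullback_structural:
  "y \<in> real_vecs (N \<uplus> (M \<uplus> P)) \<Longrightarrow>
      pullback (mk_finmap ((N \<uplus> M) \<uplus> P) (N \<uplus> (M \<uplus> P)) reassoc) y =
      (\<lambda>k\<in>(N \<uplus> M) \<uplus> P. y (reassoc k))"
  "y \<in> real_vecs N \<Longrightarrow> pullback (mk_finmap ({} \<uplus> N) N untag) y = (\<lambda>k\<in>{} \<uplus> N. y (untag k))"
  "y \<in> real_vecs N \<Longrightarrow> pullback (mk_finmap (N \<uplus> {}) N untag) y = (\<lambda>k\<in>N \<uplus> {}. y (untag k))"
  "y \<in> real_vecs (M \<uplus> N) \<Longrightarrow> pullback (mk_finmap (N \<uplus> M) (M \<uplus> N) swap_tags) y =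
      (\<lambda>k\<in>N \<uplus> M. y (swap_tags k))"
  by (simp_all add: pullback_mk disjoint_union_Pi)

text \<open>
  Fibres of the composite are partitioned by the fibres of the first map.
\<close>

lemma pushforward_comp:
  assumes \<phi>: "\<phi> \<in> hom FinSet N M" and \<psi>: "\<psi> \<in> hom FinSet M P" and x: "x \<in> real_vecs N"
  shows "pushforward (comp FinSet \<psi> \<phi>) x = pushforward \<psi> (pushforward \<phi> x)"
proof (rule real_vecs_eqI[of _ P])
  note comp = FinSet_comp_hom[OF \<phi> \<psi>]
  show "pushforward (comp FinSet \<psi> \<phi>) x \<in> real_vecs P"
    using x by (simp add: pushforward_hom[OF comp])
  show "pushforward \<psi> (pushforward \<phi> x) \<in> real_vecs P"
    using x by (simp add: pushforward_hom[OF \<phi>] pushforward_hom[OF \<psi>])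
  fix p assume p: "p \<in> P"
  let ?T = "{j. j \<in> M \<and> app \<psi> j = p}" and ?S = "{i. i \<in> N \<and> app \<psi> (app \<phi> i) = p}"
  have fib: "{i. i \<in> N \<and> app (comp FinSet \<psi> \<phi>) i = p} = ?S"
    using \<phi> \<psi> by (auto elim!: FinSet_homE)
  have "(\<Sum>j\<in>?T. \<Sum>i | i \<in> N \<and> app \<phi> i = j. x i) = (\<Sum>j\<in>?T. \<Sum>i | i \<in> ?S \<and> app \<phi> i = j. x i)"
    by (intro sum.cong) auto
  also have "\<dots> = sum x ?S"
    using \<phi> \<psi> by (intro sum.group) (auto simp: FinSet_hom_iff)
  finally show "pushforward (comp FinSet \<psi> \<phi>) x p = pushforward \<psi> (pushforward \<phi> x) p"
    using p x by (simp add: pushforward_hom[OF comp] pushforward_hom[OF \<phi>] pushforward_hom[OF \<psi>] fib)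
qed

lemma pushforward_inj:
  assumes "\<phi> \<in> hom FinSet N M" "inj_on (app \<phi>) N" "x \<in> real_vecs N" "i \<in> N"
  shows "pushforward \<phi> x (app \<phi> i) = x i"
proof -
  have "{k. k \<in> N \<and> app \<phi> k = app \<phi> i} = {i}"
    using assms by (auto dest: inj_onD)
  moreover have "app \<phi> i \<in> M"
    using assms by (auto simp: FinSet_hom_iff)
  ultimately show ?thesis
    using assms by (simp add: pushforward_hom)
qed

lemma pushforward_inclL_nth:
  assumes "finite N" "finite M" "x \<in> real_vecs N"
  shows "i \<in> N \<Longrightarrow> pushforward (inclL N M) x (InL i) = x i"
    and "j \<in> M \<Longrightarrow> pushforward (inclL N M) x (InR j) = 0"
proof -
  show "pushforward (inclL N M) x (InL i) = x i" if "i \<in> N"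
    using pushforward_inj[OF inclL_hom[OF assms(1,2)] _ assms(3) that] that
    by (simp add: inclL_def inj_on_def)
  show "pushforward (inclL N M) x (InR j) = 0" if "j \<in> M"
    unfolding pushforward_hom[OF inclL_hom[OF assms(1,2)] assms(3)]
    using that by (auto simp: inclL_def intro!: sum.neutral)
qed

lemma pushforward_inclR_nth:
  assumes "finite N" "finite M" "x \<in> real_vecs M"
  shows "j \<in> M \<Longrightarrow> pushforward (inclR N M) x (InR j) = x j"
    and "i \<in> N \<Longrightarrow> pushforward (inclR N M) x (InL i) = 0"
proof -
  show "pushforward (inclR N M) x (InR j) = x j" if "j \<in> M"
    using pushforward_inj[OF inclR_hom[OF assms(1,2)] _ assms(3) that] that
    by (simp add: inclR_def inj_on_def)
  show "pushforward (inclR N M) x (InL i) = 0" if "i \<in> N"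
    unfolding pushforward_hom[OF inclR_hom[OF assms(1,2)] assms(3)]
    using that by (auto simp: inclR_def intro!: sum.neutral)
qed

lemma continuous_on_pullback:
  assumes "\<phi> \<in> hom FinSet N M"
  shows "continuous_on (real_vecs M) (pullback \<phi>)"
proof -
  have coord: "continuous_on (real_vecs M) (\<lambda>y. y j)" for j :: "'a tagged"
    by (rule continuous_on_subset[OF continuous_on_product_coordinates]) simp
  have "continuous_on (real_vecs M) (\<lambda>y. \<lambda>i\<in>N. y (app \<phi> i))"
  proof (rule continuous_on_coordinatewise_then_product)
    show "continuous_on (real_vecs M) (\<lambda>y. (\<lambda>i\<in>N. y (app \<phi> i)) i)" for i
      by (cases "i \<in> N") (simp_all add: coord)
  qed
  then show ?thesis
    using assms by (subst continuous_on_cong[OF refl pullback_hom]) auto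
qed


section \<open>The chain rule for pullbacks\<close>

text \<open>
  A pullback copies each coordinate to a whole fibre, so varying one coordinate before it varies a
  set of coordinates with a common value after it.
\<close>

definition set_coords :: "('i \<Rightarrow> 'b) \<Rightarrow> 'i set \<Rightarrow> 'b \<Rightarrow> 'i \<Rightarrow> 'b" where
  "set_coords x S t = (\<lambda>i. if i \<in> S then t else x i)"

lemma set_coords_in_real_vecs:
  "\<lbrakk>x \<in> real_vecs N; S \<subseteq> N\<rbrakk> \<Longrightarrow> set_coords x S t \<in> real_vecs N"
  by (auto simp: real_vecs_def PiE_def extensional_def set_coords_def)

text \<open>
  Differentiability in the first variable at a single point is enough, because only the second
  partial derivative has to be controlled near the diagonal point. An induction on the number of
  moving coordinates can therefore carry a derivative alone, with no claim about its continuity.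
\<close>

lemma DERIV_diagonal:
  fixes h :: "real \<Rightarrow> real \<Rightarrow> real"
  assumes hs: "((\<lambda>s. h s t) has_real_derivative a) (at t)"
    and ht: "\<And>s t'. ((\<lambda>t'. h s t') has_real_derivative h' s t') (at t')"
    and cont: "continuous (at (t, t)) (\<lambda>(s, t'). h' s t')"
  shows "((\<lambda>s. h s s) has_real_derivative a + h' t t) (at t)"
proof -
  have "((\<lambda>(s, t'). h s t') has_derivative
      (\<lambda>(u, v). a * u + blinfun_apply (blinfun_mult_right (h' t t)) v)) (at (t, t) within UNIV \<times> UNIV)"
  proof (rule has_derivative_partialsI[where fy = "\<lambda>s t'. blinfun_mult_right (h' s t')"])
    show "((\<lambda>s. h s t) has_derivative (*) a) (at t within UNIV)"
      using hs by (simp add: has_field_derivative_def)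
    show "((\<lambda>t'. h s t') has_derivative blinfun_apply (blinfun_mult_right (h' s t'))) (at t' within UNIV)"
      for s t'
      using ht by (simp add: has_field_derivative_def)
    show "continuous (at (t, t) within UNIV \<times> UNIV) (\<lambda>(s, t'). blinfun_mult_right (h' s t'))"
      using bounded_linear.isCont[OF bounded_linear_blinfun_mult_right cont]
      by (simp add: case_prod_unfold)
  qed auto
  then have "((\<lambda>(s, t'). h s t') has_derivative (\<lambda>(u, v). a * u + h' t t * v)) (at (t, t))"
    by simp
  from has_derivative_compose[OF has_derivative_Pair[OF has_derivative_ident has_derivative_ident] this]
  have "((\<lambda>s. h s s) has_derivative (\<lambda>u. a * u + h' t t * u)) (at t)"
    by simp
  moreover have "(\<lambda>u. a * u + h' t t * u) = (*) (a + h' t t)"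
    by (simp add: fun_eq_iff distrib_right)
  ultimately show ?thesis
    by (simp add: has_field_derivative_def)
qed

lemma C1_partial_deriv:
  assumes "C1 N f" "i \<in> N" "x \<in> real_vecs N"
  shows "((\<lambda>t. f (x(i := t))) has_real_derivative partial_deriv f i (x(i := t))) (at t)"
proof -
  have "(\<lambda>u. f ((x(i := t))(i := u))) differentiable (at ((x(i := t)) i))"
    using assms fun_upd_in_real_vecs unfolding C1_def by blast
  then show ?thesis
    by (simp add: partial_deriv_def DERIV_deriv_iff_real_differentiable)
qed

text \<open>
  The coordinates in \<open>S\<close> are released one at a time. Releasing \<open>k\<close> turns the curve into the
  diagonal of a function of two parameters, the common value of the coordinates in \<open>S\<close> and the
  value of coordinate \<open>k\<close>: the first partial derivative is the induction hypothesis, the second is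
  the partial derivative of \<open>f\<close> in direction \<open>k\<close>, which is continuous.
\<close>

lemma C1_DERIV_set_coords:
  assumes "finite S" "S \<subseteq> N" "C1 N f" "x \<in> real_vecs N"
  shows "((\<lambda>t. f (set_coords x S t)) has_real_derivative
           (\<Sum>i\<in>S. partial_deriv f i (set_coords x S t))) (at t)"
  using assms(1,2,4)
proof (induction S arbitrary: x)
  case empty
  then show ?case by (simp add: set_coords_def)
next
  case (insert k S)
  have k: "k \<in> N" and S: "S \<subseteq> N" using insert.prems by auto
  let ?v = "\<lambda>s t. set_coords (x(k := t)) S s"
  have v_upd: "?v s t = (?v s u)(k := t)" for s t u
    using insert.hyps by (auto simp: set_coords_def)
  have diag: "?v t t = set_coords x (insert k S) t" for t
    by (auto simp: set_coords_def)
  have v_in: "?v s t \<in> real_vecs N" for s t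
    using insert.prems k S by (intro set_coords_in_real_vecs) auto
  \<comment> \<open>\<open>s\<close> moves the coordinates in \<open>S\<close> and the second parameter moves \<open>k\<close>.\<close>
  have "((\<lambda>s. f (?v s s)) has_real_derivative
      (\<Sum>i\<in>S. partial_deriv f i (?v t t)) + partial_deriv f k (?v t t)) (at t)"
  proof (rule DERIV_diagonal[where h = "\<lambda>s t. f (?v s t)" and h' = "\<lambda>s t. partial_deriv f k (?v s t)"])
    show "((\<lambda>s. f (?v s t)) has_real_derivative (\<Sum>i\<in>S. partial_deriv f i (?v t t))) (at t)"
      using insert.IH[OF S fun_upd_in_real_vecs[OF insert.prems(2) k]] .
    show "((\<lambda>t. f (?v s t)) has_real_derivative partial_deriv f k (?v s t')) (at t')" for s t'
      using C1_partial_deriv[OF assms(3) k v_in[where s = s and t = t'], of t']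
      by (simp only: v_upd[where s = s and u = t', symmetric])
    have v_cont: "continuous_on UNIV (\<lambda>p. ?v (fst p) (snd p))"
    proof (rule continuous_on_coordinatewise_then_product)
      fix i
      show "continuous_on UNIV (\<lambda>p. ?v (fst p) (snd p) i)"
        by (cases "i \<in> S"; cases "i = k") (auto simp: set_coords_def intro!: continuous_intros)
    qed
    have "continuous_on (real_vecs N) (partial_deriv f k)"
      using assms(3) k by (simp add: C1_def)
    then have "continuous_on UNIV (\<lambda>p. partial_deriv f k (?v (fst p) (snd p)))"
      using v_cont by (rule continuous_on_compose2) (use v_in in auto)
    then show "continuous (at (t, t)) (\<lambda>(s, t'). partial_deriv f k (?v s t'))"
      by (simp add: continuous_on_eq_continuous_at case_prod_unfold)
  qed
  then show ?case
    using insert.hyps by (simp add: diag add.commute)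
qed

text \<open>
  Moving coordinate \<open>j\<close> of \<open>y\<close> is moving the fibre over \<open>j\<close> simultaneously in the pullback of \<open>y\<close>.
\<close>

lemma DERIV_pullback:
  assumes \<phi>: "\<phi> \<in> hom FinSet N M" and f: "C1 N f" and y: "y \<in> real_vecs M" and j: "j \<in> M"
  shows "((\<lambda>t. f (pullback \<phi> (y(j := t)))) has_real_derivative
           (\<Sum>i | i \<in> N \<and> app \<phi> i = j. partial_deriv f i (pullback \<phi> y))) (at (y j))"
proof -
  let ?S = "{i \<in> N. app \<phi> i = j}"
  have upd: "pullback \<phi> (y(j := t)) = set_coords (pullback \<phi> y) ?S t" for t
    using \<phi> y j by (auto simp: pullback_hom set_coords_def)
  have "finite ?S"
    using \<phi> by (simp add: FinSet_hom_iff)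
  then show ?thesis
    using C1_DERIV_set_coords[of ?S N f "pullback \<phi> y" "y j"] \<phi> f y upd[of "y j"]
    by (simp add: upd pullback_in_real_vecs)
qed


section \<open>The functor of continuously differentiable functions\<close>

lemma Opt_obj_C1: "f \<in> Opt_obj N \<Longrightarrow> C1 N f"
  by (simp add: Opt_obj_def)

lemma Opt_obj_eqI:
  assumes "f \<in> Opt_obj N" "g \<in> Opt_obj N" "\<And>x. x \<in> real_vecs N \<Longrightarrow> f x = g x"
  shows "f = g"
  using assms by (auto simp: Opt_obj_def intro: PiE_ext)

lemma Opt_on_obj [simp]: "on_obj Opt = Opt_obj"
  by (simp add: Opt_def)

lemma Opt_on_arr:
  "\<lbrakk>\<phi> \<in> hom FinSet N M; f \<in> Opt_obj N\<rbrakk> \<Longrightarrow> on_arr Opt \<phi> f = (\<lambda>y\<in>real_vecs M. f (pullback \<phi> y))"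
  by (simp add: Opt_def FinSet_hom_iff)

lemma Opt_on_arr_apply:
  "\<lbrakk>\<phi> \<in> hom FinSet N M; f \<in> Opt_obj N; y \<in> real_vecs M\<rbrakk> \<Longrightarrow> on_arr Opt \<phi> f y = f (pullback \<phi> y)"
  by (simp add: Opt_on_arr)

lemma partial_deriv_Opt_on_arr:
  assumes "\<phi> \<in> hom FinSet N M" "f \<in> Opt_obj N" "y \<in> real_vecs M" "j \<in> M"
  shows "((\<lambda>t. on_arr Opt \<phi> f (y(j := t))) has_real_derivative
           (\<Sum>i | i \<in> N \<and> app \<phi> i = j. partial_deriv f i (pullback \<phi> y))) (at (y j))"
    and "partial_deriv (on_arr Opt \<phi> f) j y =
           (\<Sum>i | i \<in> N \<and> app \<phi> i = j. partial_deriv f i (pullback \<phi> y))"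
proof -
  show *: "((\<lambda>t. on_arr Opt \<phi> f (y(j := t))) has_real_derivative
           (\<Sum>i | i \<in> N \<and> app \<phi> i = j. partial_deriv f i (pullback \<phi> y))) (at (y j))"
    using DERIV_pullback[OF assms(1) Opt_obj_C1 assms(3,4)] assms by (simp add: Opt_on_arr)
  show "partial_deriv (on_arr Opt \<phi> f) j y =
           (\<Sum>i | i \<in> N \<and> app \<phi> i = j. partial_deriv f i (pullback \<phi> y))"
    unfolding partial_deriv_def[of "on_arr Opt \<phi> f"] using * by (rule DERIV_imp_deriv)
qed

lemma Opt_on_arr_in_Opt_obj:
  assumes "\<phi> \<in> hom FinSet N M" "f \<in> Opt_obj N"
  shows "on_arr Opt \<phi> f \<in> Opt_obj M"
proof -
  have "C1 M (on_arr Opt \<phi> f)"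
    unfolding C1_def
  proof (intro ballI conjI)
    fix j y assume "j \<in> M" "y \<in> real_vecs M"
    then show "(\<lambda>t. on_arr Opt \<phi> f (y(j := t))) differentiable at (y j)"
      using partial_deriv_Opt_on_arr(1)[OF assms] real_differentiable_def by blast
  next
    fix j assume j: "j \<in> M"
    have "continuous_on (real_vecs M)
        (\<lambda>y. \<Sum>i | i \<in> N \<and> app \<phi> i = j. partial_deriv f i (pullback \<phi> y))"
    proof (intro continuous_on_sum)
      fix i assume "i \<in> {i. i \<in> N \<and> app \<phi> i = j}"
      then have "continuous_on (real_vecs N) (partial_deriv f i)"
        using Opt_obj_C1[OF assms(2)] by (simp add: C1_def)
      then show "continuous_on (real_vecs M) (\<lambda>y. partial_deriv f i (pullback \<phi> y))"
        by (rule continuous_on_compose2[OF _ continuous_on_pullback[OF assms(1)]])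
          (use pullback_in_real_vecs[OF assms(1)] in auto)
    qed
    then show "continuous_on (real_vecs M) (partial_deriv (on_arr Opt \<phi> f) j)"
      using partial_deriv_Opt_on_arr(2)[OF assms] j by (subst continuous_on_cong) auto
  qed
  then show ?thesis
    using assms by (simp add: Opt_obj_def Opt_on_arr)
qed

text \<open>
  The derivative of the composite is the derivative of \<open>f\<close> preceded by the linear map pullback;
  expressed by gradients, this applies the transpose of pullback, which is pushforward.
\<close>

lemma grad_Opt_on_arr:
  assumes "\<phi> \<in> hom FinSet N M" "f \<in> Opt_obj N" "y \<in> real_vecs M"
  shows "grad M (on_arr Opt \<phi> f) y = pushforward \<phi> (grad N f (pullback \<phi> y))"
proof -
  have "grad N f (pullback \<phi> y) = (\<lambda>i\<in>N. partial_deriv f i (pullback \<phi> y))"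
    using assms by (simp add: grad_def pullback_in_real_vecs)
  then show ?thesis
    using assms(3) partial_deriv_Opt_on_arr(2)[OF assms]
    by (auto simp: grad_def pushforward_hom[OF assms(1)] intro!: restrict_ext)
qed

lemma Opt_obj_add:
  assumes "f \<in> Opt_obj N" "g \<in> Opt_obj N"
  shows "(\<lambda>x\<in>real_vecs N. f x + g x) \<in> Opt_obj N"
    and "x \<in> real_vecs N \<Longrightarrow>
      grad N (\<lambda>x\<in>real_vecs N. f x + g x) x = vadd N (grad N f x) (grad N g x)"
proof -
  let ?h = "\<lambda>x\<in>real_vecs N. f x + g x"
  have D: "((\<lambda>t. ?h (x(i := t))) has_real_derivative partial_deriv f i x + partial_deriv g i x)
      (at (x i))" if "i \<in> N" "x \<in> real_vecs N" for i x
    using DERIV_add[OF C1_partial_deriv[OF Opt_obj_C1[OF assms(1)] that, of "x i"]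
        C1_partial_deriv[OF Opt_obj_C1[OF assms(2)] that, of "x i"]] that by simp
  then have P: "partial_deriv ?h i x = partial_deriv f i x + partial_deriv g i x"
    if "i \<in> N" "x \<in> real_vecs N" for i x
    unfolding partial_deriv_def[of ?h] by (intro DERIV_imp_deriv that D)
  have "C1 N ?h"
    unfolding C1_def
  proof (intro ballI conjI)
    fix i x assume "i \<in> N" "x \<in> real_vecs N"
    then show "(\<lambda>t. ?h (x(i := t))) differentiable at (x i)"
      using D real_differentiable_def by blast
  next
    fix i assume i: "i \<in> N"
    then have "continuous_on (real_vecs N) (\<lambda>x. partial_deriv f i x + partial_deriv g i x)"
      using Opt_obj_C1[OF assms(1)] Opt_obj_C1[OF assms(2)] unfolding C1_def
      by (intro continuous_on_add) auto
    then show "continuous_on (real_vecs N) (partial_deriv ?h i)"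
      using P[OF i] by (subst continuous_on_cong) auto
  qed
  then show "?h \<in> Opt_obj N"
    by (simp add: Opt_obj_def)
  show "grad N ?h x = vadd N (grad N f x) (grad N g x)" if "x \<in> real_vecs N"
    using that P by (auto simp: grad_def vadd_def intro!: restrict_ext)
qed

lemma Opt_prod:
  "\<lbrakk>f \<in> Opt_obj N; g \<in> Opt_obj M\<rbrakk> \<Longrightarrow> prod_comparison Opt N M (f, g) =
     (\<lambda>z\<in>real_vecs (N \<uplus> M). f (pullback (inclL N M) z) + g (pullback (inclR N M) z))"
  by (simp add: Opt_def)

lemma Opt_prod_apply:
  "\<lbrakk>f \<in> Opt_obj N; g \<in> Opt_obj M; z \<in> real_vecs (N \<uplus> M)\<rbrakk> \<Longrightarrow> prod_comparison Opt N M (f, g) z =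
     f (pullback (inclL N M) z) + g (pullback (inclR N M) z)"
  by (simp add: Opt_prod)

text \<open>
  The product comparison is a sum of two pullbacks along inclusions, so that its smoothness and
  its gradient follow from the case of a single arrow.
\<close>

lemma Opt_prod_conv_on_arr:
  assumes "finite N" "finite M" "f \<in> Opt_obj N" "g \<in> Opt_obj M"
  shows "prod_comparison Opt N M (f, g) =
     (\<lambda>z\<in>real_vecs (N \<uplus> M). on_arr Opt (inclL N M) f z + on_arr Opt (inclR N M) g z)"
  using assms by (auto simp: Opt_prod Opt_on_arr[OF inclL_hom] Opt_on_arr[OF inclR_hom] intro!: restrict_ext)

lemma Opt_prod_in_Opt_obj:
  assumes "finite N" "finite M" "f \<in> Opt_obj N" "g \<in> Opt_obj M"
  shows "prod_comparison Opt N M (f, g) \<in> Opt_obj (N \<uplus> M)"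
  unfolding Opt_prod_conv_on_arr[OF assms]
  using assms by (intro Opt_obj_add Opt_on_arr_in_Opt_obj[OF inclL_hom] Opt_on_arr_in_Opt_obj[OF inclR_hom])

lemma grad_Opt_prod:
  assumes "finite N" "finite M" "f \<in> Opt_obj N" "g \<in> Opt_obj M" "z \<in> real_vecs (N \<uplus> M)"
  shows "grad (N \<uplus> M) (prod_comparison Opt N M (f, g)) z =
    vadd (N \<uplus> M) (pushforward (inclL N M) (grad N f (pullback (inclL N M) z)))
                  (pushforward (inclR N M) (grad M g (pullback (inclR N M) z)))"
  unfolding Opt_prod_conv_on_arr[OF assms(1-4)]
  using assms
  by (simp add: Opt_obj_add(2) Opt_on_arr_in_Opt_obj[OF inclL_hom] Opt_on_arr_in_Opt_obj[OF inclR_hom]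
      grad_Opt_on_arr[OF inclL_hom] grad_Opt_on_arr[OF inclR_hom])

lemma Opt_zero: "(\<lambda>z\<in>real_vecs N. 0) \<in> Opt_obj N"
proof -
  let ?f = "\<lambda>z\<in>real_vecs N. 0 :: real"
  have "partial_deriv ?f i x = 0" if "i \<in> N" "x \<in> real_vecs N" for i x
    using that by (simp add: partial_deriv_def)
  then have "continuous_on (real_vecs N) (partial_deriv ?f i)" if "i \<in> N" for i
    using that by (subst continuous_on_cong[where g = "\<lambda>_. 0"]) auto
  then show ?thesis
    by (simp add: Opt_obj_def C1_def)
qed

lemma Opt_unit:
  "unit_comparison Opt () \<in> Opt_obj {}"
  "unit_comparison Opt () (\<lambda>i. undefined) = 0"
  by (simp add: Opt_def Opt_zero) (simp add: Opt_def real_vecs_def)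

theorem lax_symmetric_monoidal_Opt:
  "lax_symmetric_monoidal_functor FinSet (Opt :: ('a tagged set, 'a finmap, _) set_functor)"
proof (rule lax_symmetric_monoidal_functor.intro[OF symmetric_monoidal_FinSet],
    rule lax_symmetric_monoidal_functor_axioms.intro, goal_cases on_arr_hom on_arr_ident on_arr_comp
    prod_comparison_hom unit_comparison_hom prod_comparison_natural lax_associativity
    lax_left_unit lax_right_unit lax_symmetry)
  case (on_arr_hom \<phi> N M)
  then have "on_arr Opt \<phi> \<in> extensional (Opt_obj N)"
    by (simp add: Opt_def FinSet_hom_iff)
  with on_arr_hom show ?case
    by (auto simp: PiE_def Opt_on_arr_in_Opt_obj)
next
  case (on_arr_ident N f)
  then have id: "ident FinSet N \<in> hom FinSet N N"
    by (simp add: mk_finmap_hom)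
  show ?case
    using on_arr_ident Opt_on_arr_in_Opt_obj[OF id] Opt_on_arr_apply[OF id]
    by (intro Opt_obj_eqI[of _ N]) (simp_all only: pullback_ident Opt_on_obj)
next
  case (on_arr_comp \<phi> N M \<psi> P f)
  note comp = FinSet_comp_hom[OF on_arr_comp(1,2)]
  show ?case
    using on_arr_comp Opt_on_arr_in_Opt_obj[OF comp]
    by (intro Opt_obj_eqI[of _ P]) (simp_all add: Opt_on_arr_in_Opt_obj Opt_on_arr_apply
        Opt_on_arr_apply[OF comp] pullback_comp pullback_in_real_vecs)
next
  case (prod_comparison_hom N M)
  have "prod_comparison Opt N M \<in> extensional (Opt_obj N \<times> Opt_obj M)"
    by (simp add: Opt_def)
  with prod_comparison_hom show ?case
    by (auto simp: PiE_def Opt_prod_in_Opt_obj)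
next
  case unit_comparison_hom
  then show ?case
    by (simp add: Opt_def Opt_zero PiE_iff)
next
  case (prod_comparison_natural \<phi> N N' \<psi> M M' f g)
  note fin = prod_comparison_natural(1,2)[unfolded FinSet_hom_iff]
  note tens = tensor_arr_hom[OF prod_comparison_natural(1,2)]
  show ?case
    using prod_comparison_natural fin tens pullback_in_real_vecs[OF tens]
    by (intro Opt_obj_eqI[of _ "N' \<uplus> M'"])
      (simp_all add: Opt_on_arr_in_Opt_obj[OF tens] Opt_on_arr_apply[OF tens] Opt_on_arr_in_Opt_obj
        Opt_on_arr_apply Opt_prod_in_Opt_obj Opt_prod_apply pullback_tensor_arr
        pullback_in_real_vecs[OF inclL_hom] pullback_in_real_vecs[OF inclR_hom])
next
  case (lax_associativity N M P f g h)
  then show ?case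
    by (intro Opt_obj_eqI[of _ "N \<uplus> (M \<uplus> P)"])
      (simp_all add: Opt_on_arr_in_Opt_obj[OF structural_homs(1)] Opt_on_arr_apply[OF structural_homs(1)]
        Opt_prod_in_Opt_obj Opt_prod_apply pullback_structural pullback_inclL pullback_inclR
        cong: restrict_cong)
next
  case (lax_left_unit N f)
  then show ?case
    by (intro Opt_obj_eqI[of _ N])
      (simp_all add: Opt_on_arr_in_Opt_obj[OF structural_homs(2)] Opt_on_arr_apply[OF structural_homs(2)]
        Opt_unit Opt_prod_in_Opt_obj Opt_prod_apply pullback_structural pullback_inclL pullback_inclR
        real_vecs_restrict_id cong: restrict_cong)
next
  case (lax_right_unit N f)
  then show ?case
    by (intro Opt_obj_eqI[of _ N])
      (simp_all add: Opt_on_arr_in_Opt_obj[OF structural_homs(3)] Opt_on_arr_apply[OF structural_homs(3)]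
        Opt_unit Opt_prod_in_Opt_obj Opt_prod_apply pullback_structural pullback_inclL pullback_inclR
        real_vecs_restrict_id cong: restrict_cong)
next
  case (lax_symmetry N M f g)
  then show ?case
    by (intro Opt_obj_eqI[of _ "M \<uplus> N"])
      (simp_all add: Opt_on_arr_in_Opt_obj[OF structural_homs(4)] Opt_on_arr_apply[OF structural_homs(4)]
        Opt_prod_in_Opt_obj Opt_prod_apply pullback_structural pullback_inclL pullback_inclR
        cong: restrict_cong)
qed


section \<open>The functor of discrete dynamical systems\<close>

lemma Dynam_on_obj [simp]: "on_obj Dynam = Dynam_obj"
  by (simp add: Dynam_def)

lemma Dynam_on_arr:
  "\<lbrakk>\<phi> \<in> hom FinSet N M; \<upsilon> \<in> Dynam_obj N\<rbrakk> \<Longrightarrow> on_arr Dynam \<phi> \<upsilon> =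
     (\<lambda>y\<in>real_vecs M. vadd M y (pushforward \<phi> (vsub N (\<upsilon> (pullback \<phi> y)) (pullback \<phi> y))))"
  by (simp add: Dynam_def FinSet_hom_iff)

lemma Dynam_on_arr_in_Dynam_obj:
  "\<lbrakk>\<phi> \<in> hom FinSet N M; \<upsilon> \<in> Dynam_obj N\<rbrakk> \<Longrightarrow> on_arr Dynam \<phi> \<upsilon> \<in> Dynam_obj M"
  by (simp add: Dynam_on_arr) (simp add: Dynam_obj_def)

lemma Dynam_obj_app: "\<lbrakk>\<upsilon> \<in> Dynam_obj N; x \<in> real_vecs N\<rbrakk> \<Longrightarrow> \<upsilon> x \<in> real_vecs N"
  by (auto simp: Dynam_obj_def)

lemma Dynam_obj_eqI:
  assumes "\<upsilon> \<in> Dynam_obj N" "\<rho> \<in> Dynam_obj N"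
    and "\<And>x i. \<lbrakk>x \<in> real_vecs N; i \<in> N\<rbrakk> \<Longrightarrow> \<upsilon> x i = \<rho> x i"
  shows "\<upsilon> = \<rho>"
proof (rule PiE_ext[OF assms(1,2)[unfolded Dynam_obj_def]])
  show "\<upsilon> x = \<rho> x" if "x \<in> real_vecs N" for x
    using that assms by (intro real_vecs_eqI[of _ N]) (auto simp: Dynam_obj_app)
qed

lemma Dynam_on_arr_nth:
  assumes "\<phi> \<in> hom FinSet N M" "\<upsilon> \<in> Dynam_obj N" "y \<in> real_vecs M" "j \<in> M"
  shows "on_arr Dynam \<phi> \<upsilon> y j = y j + (\<Sum>i | i \<in> N \<and> app \<phi> i = j. \<upsilon> (pullback \<phi> y) i - y j)"
proof -
  have "(\<Sum>i | i \<in> N \<and> app \<phi> i = j. vsub N (\<upsilon> (pullback \<phi> y)) (pullback \<phi> y) i) =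
      (\<Sum>i | i \<in> N \<and> app \<phi> i = j. \<upsilon> (pullback \<phi> y) i - y j)"
    using assms by (intro sum.cong) (auto simp: pullback_hom)
  then show ?thesis
    using assms by (simp add: Dynam_on_arr pushforward_hom)
qed

text \<open>
  An arrow acts on the displacement \<open>\<upsilon> - id\<close> by placing it between pullback and pushforward, so
  functoriality is inherited from these two.
\<close>

lemma Dynam_on_arr_comp:
  assumes \<phi>: "\<phi> \<in> hom FinSet N M" and \<psi>: "\<psi> \<in> hom FinSet M P" and \<upsilon>: "\<upsilon> \<in> Dynam_obj N"
  shows "on_arr Dynam (comp FinSet \<psi> \<phi>) \<upsilon> = on_arr Dynam \<psi> (on_arr Dynam \<phi> \<upsilon>)"
proof -
  have "vsub M (on_arr Dynam \<phi> \<upsilon> y) y = pushforward \<phi> (vsub N (\<upsilon> (pullback \<phi> y)) (pullback \<phi> y))"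
    if "y \<in> real_vecs M" for y
    using that \<phi> \<upsilon>
    by (intro real_vecs_eqI[of _ M]) (simp_all add: Dynam_on_arr pushforward_in_real_vecs)
  then show ?thesis
    using assms
    by (auto simp: Dynam_on_arr[OF FinSet_comp_hom[OF \<phi> \<psi>]] Dynam_on_arr[OF \<psi> Dynam_on_arr_in_Dynam_obj[OF \<phi> \<upsilon>]]
        pullback_comp pushforward_comp pullback_in_real_vecs intro!: restrict_ext)
qed

lemma Dynam_on_arr_inj:
  assumes "\<phi> \<in> hom FinSet N M" "inj_on (app \<phi>) N" "\<upsilon> \<in> Dynam_obj N" "y \<in> real_vecs M" "i \<in> N"
  shows "on_arr Dynam \<phi> \<upsilon> y (app \<phi> i) = \<upsilon> (pullback \<phi> y) i"
proof -
  have "app \<phi> i \<in> M"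
    using assms by (auto simp: FinSet_hom_iff)
  then show ?thesis
    using assms by (simp add: Dynam_on_arr pushforward_inj) (simp add: pullback_hom)
qed

text \<open>
  All structural arrows are bijections, along which a system is merely relabelled. The coherence
  axioms thereby reduce to evaluations on the elements of disjoint unions.
\<close>

lemma Dynam_on_arr_bij:
  assumes "bij_betw f N M" "finite N" "\<upsilon> \<in> Dynam_obj N" "\<rho> \<in> Dynam_obj M"
    and "\<And>y i. \<lbrakk>y \<in> real_vecs M; i \<in> N\<rbrakk> \<Longrightarrow> \<upsilon> (\<lambda>k\<in>N. y (f k)) i = \<rho> y (f i)"
  shows "on_arr Dynam (mk_finmap N M f) \<upsilon> = \<rho>"
proof (rule Dynam_obj_eqI[of _ M])
  let ?\<phi> = "mk_finmap N M f"
  have hom: "?\<phi> \<in> hom FinSet N M"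
    using mk_finmap_iso[OF assms(2,1)] by (simp add: iso_def)
  then show "on_arr Dynam ?\<phi> \<upsilon> \<in> Dynam_obj M"
    using assms(3) by (rule Dynam_on_arr_in_Dynam_obj)
  have f: "f \<in> N \<rightarrow> M" "inj_on f N"
    using bij_betw_imp_funcset[OF assms(1)] bij_betw_imp_inj_on[OF assms(1)] .
  fix y j assume y: "y \<in> real_vecs M" and "j \<in> M"
  then obtain i where i: "i \<in> N" "j = f i"
    using assms(1) by (auto simp: bij_betw_def)
  then show "on_arr Dynam ?\<phi> \<upsilon> y j = \<rho> y j"
    using Dynam_on_arr_inj[OF hom _ assms(3) y i(1)] f assms(5)[OF y i(1)] y
    by (simp add: pullback_mk inj_on_def)
qed (fact assms)

lemma Dynam_prod:
  "\<lbrakk>\<upsilon> \<in> Dynam_obj N; \<rho> \<in> Dynam_obj M\<rbrakk> \<Longrightarrow> prod_comparison Dynam N M (\<upsilon>, \<rho>) =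
     (\<lambda>z\<in>real_vecs (N \<uplus> M).
         vadd (N \<uplus> M) (pushforward (inclL N M) (\<upsilon> (pullback (inclL N M) z)))
                      (pushforward (inclR N M) (\<rho> (pullback (inclR N M) z))))"
  by (simp add: Dynam_def)

lemma Dynam_prod_in_Dynam_obj:
  "\<lbrakk>\<upsilon> \<in> Dynam_obj N; \<rho> \<in> Dynam_obj M\<rbrakk> \<Longrightarrow> prod_comparison Dynam N M (\<upsilon>, \<rho>) \<in> Dynam_obj (N \<uplus> M)"
  by (simp add: Dynam_prod) (simp add: Dynam_obj_def)

lemma Dynam_prod_nth:
  assumes "finite N" "finite M" "\<upsilon> \<in> Dynam_obj N" "\<rho> \<in> Dynam_obj M" "z \<in> real_vecs (N \<uplus> M)"
  shows "i \<in> N \<Longrightarrow> prod_comparison Dynam N M (\<upsilon>, \<rho>) z (InL i) = \<upsilon> (\<lambda>k\<in>N. z (InL k)) i"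
    and "j \<in> M \<Longrightarrow> prod_comparison Dynam N M (\<upsilon>, \<rho>) z (InR j) = \<rho> (\<lambda>k\<in>M. z (InR k)) j"
  using assms
  by (simp_all add: Dynam_prod pullback_inclL pullback_inclR Dynam_obj_app
      pushforward_inclL_nth pushforward_inclR_nth)

text \<open>
  The fibre of \<open>\<phi> + \<psi>\<close> over a point of one summand lies in that summand, where it is the fibre
  of \<open>\<phi>\<close> or of \<open>\<psi>\<close>; the sums over fibres that define both sides therefore agree.
\<close>

lemma Dynam_prod_natural:
  assumes \<phi>: "\<phi> \<in> hom FinSet N N'" and \<psi>: "\<psi> \<in> hom FinSet M M'"
    and \<upsilon>: "\<upsilon> \<in> Dynam_obj N" and \<rho>: "\<rho> \<in> Dynam_obj M"
  shows "on_arr Dynam (tensor_arr FinSet \<phi> \<psi>) (prod_comparison Dynam N M (\<upsilon>, \<rho>)) =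
    prod_comparison Dynam N' M' (on_arr Dynam \<phi> \<upsilon>, on_arr Dynam \<psi> \<rho>)"
proof (rule Dynam_obj_eqI[of _ "N' \<uplus> M'"])
  note fin = \<phi>[unfolded FinSet_hom_iff] \<psi>[unfolded FinSet_hom_iff]
  note tens = tensor_arr_hom[OF \<phi> \<psi>]
  let ?t = "tensor_arr FinSet \<phi> \<psi>"
  show "on_arr Dynam ?t (prod_comparison Dynam N M (\<upsilon>, \<rho>)) \<in> Dynam_obj (N' \<uplus> M')"
    using Dynam_on_arr_in_Dynam_obj[OF tens Dynam_prod_in_Dynam_obj[OF \<upsilon> \<rho>]] .
  show "prod_comparison Dynam N' M' (on_arr Dynam \<phi> \<upsilon>, on_arr Dynam \<psi> \<rho>) \<in> Dynam_obj (N' \<uplus> M')"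
    using assms by (intro Dynam_prod_in_Dynam_obj Dynam_on_arr_in_Dynam_obj)
  fix z k assume z: "z \<in> real_vecs (N' \<uplus> M')" and "k \<in> N' \<uplus> M'"
  note tz = pullback_in_real_vecs[OF tens z]
  have fibL: "{k. k \<in> N \<uplus> M \<and> app ?t k = InL j} = InL ` {i. i \<in> N \<and> app \<phi> i = j}" for j
    using \<phi> \<psi> by (auto elim!: FinSet_homE disjoint_unionE)
  have fibR: "{k. k \<in> N \<uplus> M \<and> app ?t k = InR j} = InR ` {i. i \<in> M \<and> app \<psi> i = j}" for j
    using \<phi> \<psi> by (auto elim!: FinSet_homE disjoint_unionE)
  have pL: "(\<lambda>k\<in>N. pullback ?t z (InL k)) = pullback \<phi> (\<lambda>k\<in>N'. z (InL k))"
    and pR: "(\<lambda>k\<in>M. pullback ?t z (InR k)) = pullback \<psi> (\<lambda>k\<in>M'. z (InR k))"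
    using pullback_tensor_arr[OF \<phi> \<psi> z] z tz by (simp_all add: pullback_inclL pullback_inclR)
  from \<open>k \<in> N' \<uplus> M'\<close>
  show "on_arr Dynam ?t (prod_comparison Dynam N M (\<upsilon>, \<rho>)) z k =
      prod_comparison Dynam N' M' (on_arr Dynam \<phi> \<upsilon>, on_arr Dynam \<psi> \<rho>) z k"
  proof (cases rule: disjoint_unionE)
    case (1 j)
    show ?thesis
      using 1 fin \<phi> \<psi> \<upsilon> \<rho> z tz
      by (simp add: Dynam_on_arr_nth[OF tens] Dynam_prod_in_Dynam_obj fibL sum.reindex inj_on_def
          Dynam_prod_nth Dynam_on_arr_in_Dynam_obj Dynam_on_arr_nth[OF \<phi>] pL)
  next
    case (2 j)
    show ?thesis
      using 2 fin \<phi> \<psi> \<upsilon> \<rho> z tz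
      by (simp add: Dynam_on_arr_nth[OF tens] Dynam_prod_in_Dynam_obj fibR sum.reindex inj_on_def
          Dynam_prod_nth Dynam_on_arr_in_Dynam_obj Dynam_on_arr_nth[OF \<psi>] pR)
  qed
qed

lemma Dynam_unit: "unit_comparison Dynam () \<in> Dynam_obj {}"
  by (auto simp: Dynam_def Dynam_obj_def)

theorem lax_symmetric_monoidal_Dynam:
  "lax_symmetric_monoidal_functor FinSet (Dynam :: ('a tagged set, 'a finmap, _) set_functor)"
proof (rule lax_symmetric_monoidal_functor.intro[OF symmetric_monoidal_FinSet],
    rule lax_symmetric_monoidal_functor_axioms.intro, goal_cases on_arr_hom on_arr_ident on_arr_comp
    prod_comparison_hom unit_comparison_hom prod_comparison_natural lax_associativity
    lax_left_unit lax_right_unit lax_symmetry)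
  case (on_arr_hom \<phi> N M)
  then have "on_arr Dynam \<phi> \<in> extensional (Dynam_obj N)"
    by (simp add: Dynam_def FinSet_hom_iff)
  with on_arr_hom show ?case
    by (auto simp: PiE_def Dynam_on_arr_in_Dynam_obj)
next
  case (on_arr_ident N \<upsilon>)
  then show ?case
    by (simp add: Dynam_on_arr_bij real_vecs_restrict_id bij_betw_def)
next
  case (on_arr_comp \<phi> N M \<psi> P \<upsilon>)
  then show ?case
    by (simp add: Dynam_on_arr_comp del: FinSet_comp)
next
  case (prod_comparison_hom N M)
  have "prod_comparison Dynam N M \<in> extensional (Dynam_obj N \<times> Dynam_obj M)"
    by (simp add: Dynam_def)
  with prod_comparison_hom show ?case
    by (auto simp: PiE_def Dynam_prod_in_Dynam_obj)
next
  case unit_comparison_hom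
  then show ?case
    by (auto simp: Dynam_def Dynam_obj_def)
next
  case (prod_comparison_natural \<phi> N N' \<psi> M M' \<upsilon> \<rho>)
  then show ?case
    by (simp add: Dynam_prod_natural)
next
  case (lax_associativity N M P \<upsilon> \<rho> \<sigma>)
  then show ?case
    by (auto intro!: Dynam_on_arr_bij structural_bijections Dynam_prod_in_Dynam_obj
      Dynam_unit elim!: disjoint_unionE simp: Dynam_prod_nth Dynam_prod_in_Dynam_obj cong: restrict_cong)
next
  case (lax_left_unit N \<upsilon>)
  then show ?case
    by (auto intro!: Dynam_on_arr_bij structural_bijections Dynam_prod_in_Dynam_obj
      Dynam_unit elim!: disjoint_unionE simp: Dynam_prod_nth Dynam_unit real_vecs_restrict_id cong: restrict_cong)
next
  case (lax_right_unit N \<upsilon>)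
  then show ?case
    by (auto intro!: Dynam_on_arr_bij structural_bijections Dynam_prod_in_Dynam_obj
      Dynam_unit elim!: disjoint_unionE simp: Dynam_prod_nth Dynam_unit real_vecs_restrict_id cong: restrict_cong)
next
  case (lax_symmetry N M \<upsilon> \<rho>)
  then show ?case
    by (auto intro!: Dynam_on_arr_bij structural_bijections Dynam_prod_in_Dynam_obj
      Dynam_unit elim!: disjoint_unionE simp: Dynam_prod_nth cong: restrict_cong)
qed


section \<open>Gradient descent\<close>

text \<open>
  The restriction to \<open>Opt_obj N\<close> makes each component an extensional function, as the arrows of
  the category of sets are.
\<close>

definition gradient_step ::
  "real \<Rightarrow> 'a tagged set \<Rightarrow> (('a tagged \<Rightarrow> real) \<Rightarrow> real) \<Rightarrow> ('a tagged \<Rightarrow> real) \<Rightarrow> ('a tagged \<Rightarrow> real)" where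
  "gradient_step \<gamma> N = (\<lambda>f\<in>Opt_obj N. \<lambda>x\<in>real_vecs N. vsub N x (vscale N \<gamma> (grad N f x)))"

lemma grad_in_real_vecs [simp]: "x \<in> real_vecs N \<Longrightarrow> grad N f x \<in> real_vecs N"
  by (simp add: grad_def)

lemma gradient_step_in_Dynam_obj: "f \<in> Opt_obj N \<Longrightarrow> gradient_step \<gamma> N f \<in> Dynam_obj N"
  by (simp add: gradient_step_def Dynam_obj_def)

lemma gradient_step_nth:
  "\<lbrakk>f \<in> Opt_obj N; x \<in> real_vecs N; i \<in> N\<rbrakk> \<Longrightarrow> gradient_step \<gamma> N f x i = x i - \<gamma> * grad N f x i"
  by (simp add: gradient_step_def)

text \<open>
  The displacement of a gradient step is the gradient scaled by \<open>- \<gamma>\<close>, and the chain rule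
  transforms gradients by the same pullback and pushforward as arrows transform displacements.
\<close>

lemma gradient_step_natural:
  assumes \<phi>: "\<phi> \<in> hom FinSet N M" and f: "f \<in> Opt_obj N"
  shows "gradient_step \<gamma> M (on_arr Opt \<phi> f) = on_arr Dynam \<phi> (gradient_step \<gamma> N f)"
proof (rule Dynam_obj_eqI[of _ M])
  fix y j assume y: "y \<in> real_vecs M" and j: "j \<in> M"
  let ?F = "{i. i \<in> N \<and> app \<phi> i = j}" and ?x = "pullback \<phi> y"
  have x: "?x \<in> real_vecs N"
    using \<phi> y by (rule pullback_in_real_vecs)
  have "gradient_step \<gamma> M (on_arr Opt \<phi> f) y j = y j - \<gamma> * (\<Sum>i\<in>?F. grad N f ?x i)"
    using assms y j x
    by (simp add: gradient_step_nth Opt_on_arr_in_Opt_obj grad_Opt_on_arr pushforward_hom)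
  also have "\<dots> = y j + (\<Sum>i\<in>?F. gradient_step \<gamma> N f ?x i - y j)"
  proof -
    have "gradient_step \<gamma> N f ?x i - y j = - (\<gamma> * grad N f ?x i)" if "i \<in> ?F" for i
      using that \<phi> f x y by (simp add: gradient_step_nth) (simp add: pullback_hom)
    then show ?thesis
      by (simp add: sum_negf sum_distrib_left)
  qed
  also have "\<dots> = on_arr Dynam \<phi> (gradient_step \<gamma> N f) y j"
    using assms y j by (simp add: Dynam_on_arr_nth gradient_step_in_Dynam_obj)
  finally show "gradient_step \<gamma> M (on_arr Opt \<phi> f) y j = on_arr Dynam \<phi> (gradient_step \<gamma> N f) y j" .
qed (use assms in \<open>simp_all add: gradient_step_in_Dynam_obj Opt_on_arr_in_Opt_obj Dynam_on_arr_in_Dynam_obj\<close>)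

text \<open>
  On each summand, the gradient of the sum is the gradient of the function living there, because
  the pushforward along the other inclusion vanishes there.
\<close>

lemma gradient_step_prod:
  assumes fin: "finite N" "finite M" and f: "f \<in> Opt_obj N" and g: "g \<in> Opt_obj M"
  shows "gradient_step \<gamma> (N \<uplus> M) (prod_comparison Opt N M (f, g)) =
    prod_comparison Dynam N M (gradient_step \<gamma> N f, gradient_step \<gamma> M g)"
proof (rule Dynam_obj_eqI[of _ "N \<uplus> M"])
  fix z k assume z: "z \<in> real_vecs (N \<uplus> M)" and k: "k \<in> N \<uplus> M"
  from k show "gradient_step \<gamma> (N \<uplus> M) (prod_comparison Opt N M (f, g)) z k =
      prod_comparison Dynam N M (gradient_step \<gamma> N f, gradient_step \<gamma> M g) z k"
    using assms z
    by (cases rule: disjoint_unionE)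
      (simp_all add: gradient_step_nth Opt_prod_in_Opt_obj grad_Opt_prod Dynam_prod_nth
        gradient_step_in_Dynam_obj pushforward_inclL_nth pushforward_inclR_nth
        pullback_inclL pullback_inclR)
qed (use assms in \<open>simp_all add: gradient_step_in_Dynam_obj Opt_prod_in_Opt_obj Dynam_prod_in_Dynam_obj\<close>)

theorem corollary3p3p1:
  fixes \<gamma> :: real
  assumes "\<gamma> > 0"
  shows "\<exists>gd :: 'a tagged set \<Rightarrow> (('a tagged \<Rightarrow> real) \<Rightarrow> real)
                 \<Rightarrow> ('a tagged \<Rightarrow> real) \<Rightarrow> ('a tagged \<Rightarrow> real).
    monoidal_natural_transformation FinSet Opt Dynam gd \<and>
    (\<forall>N f. finite N \<longrightarrow> f \<in> Opt_obj N \<longrightarrow>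
       gd N f = (\<lambda>x\<in>real_vecs N. vsub N x (vscale N \<gamma> (grad N f x))))"
proof (intro exI conjI allI impI)
  show "monoidal_natural_transformation FinSet Opt Dynam (gradient_step \<gamma>)"
  proof (intro monoidal_natural_transformation.intro monoidal_natural_transformation_axioms.intro
      lax_symmetric_monoidal_Opt lax_symmetric_monoidal_Dynam,
      goal_cases component_hom natural monoidal_prod monoidal_unit)
    case (component_hom N)
    have "gradient_step \<gamma> N \<in> extensional (Opt_obj N)"
      by (simp add: gradient_step_def)
    then show ?case
      by (auto simp: PiE_def gradient_step_in_Dynam_obj)
  next
    case (natural \<phi> N M f)
    then show ?case
      by (simp add: gradient_step_natural)
  next
    case (monoidal_prod N M f g)
    then show ?case
      by (simp add: gradient_step_prod)
  next
    case monoidal_unit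
    then show ?case
      by (auto intro!: Dynam_obj_eqI[of _ "{}"] simp: gradient_step_in_Dynam_obj Opt_unit Dynam_unit)
  qed
  show "gradient_step \<gamma> N f = (\<lambda>x\<in>real_vecs N. vsub N x (vscale N \<gamma> (grad N f x)))"
    if "f \<in> Opt_obj N" for N and f :: "('a tagged \<Rightarrow> real) \<Rightarrow> real"
    using that by (simp add: gradient_step_def)
qed

end
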